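(* Let $A\in\mathbb{R}_+^{m\times n}$ be a nonnegative matrix and let $r\ge 1$ be an integer. Let $(U^k,V^k)_{k\ge 0}$, with $U^k=(u_1^k\ \cdots\ u_r^k)\in\mathbb{R}_+^{m\times r}$ and $V^k=(v_1^k\ \cdots\ v_r^k)\in\mathbb{R}_+^{n\times r}$, be the sequence of iterates generated by the Rank-one Residue Iteration (RRI) algorithm applied to $A$ from a nonnegative initialization, where $(U^k,V^k)$ denotes the values of the variables after $k$ full sweeps. Then every limit point $(U^*,V^* )$ of this sequence is a stationary point of the nonnegative matrix factorization problem $$\min_{U\in\mathbb{R}_+^{m\times r},\ V\in\mathbb{R}_+^{n\times r}}\tfrac12\|A-UV^T\|_F^2 .$$
   Context: Notation: $[x]_+$ is the projection of a real vector $x$ on the nonnegative orthant (negative entries are set to $0$); $\|\cdot\|_F$ is the Frobenius norm; $\circ$ is the elementwise product; inequalities between matrices or vectors are elementwise. RRI algorithm. Initialize nonnegative vectors $u_i\in\mathbb{R}_+^m$, $v_i\in\mathbb{R}_+^n$ for $i=1,\dots,r$. Repeat the following sweep: for $t=1,2,\dots,r$ in this order, using the current values of all variables, 1. set $R_t=A-\sum_{i\ne t}u_iv_i^T$; 2. if $[R_t^Tu_t]_+\neq 0$, replace $v_t$ by $\frac{[R_t^Tu_t]_+}{\|u_t\|_2^2}$; otherwise set $v_t=0$; 3. then (with the new $v_t$) if $[R_tv_t]_+\ne 0$, replace $u_t$ by $\frac{[R_tv_t]_+}{\|v_t\|_2^2}$; otherwise set $u_t=0$. Stationary point of the nonnegative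 matrix factorization problem: a pair $(U,V)$ satisfying the KKT conditions $$U\ge 0,\quad V\ge 0,\quad UV^TV-AV\ge 0,\quad VU^TU-A^TU\ge 0,$$ $$U\circ(UV^TV-AV)=0,\quad V\circ(VU^TU-A^TU)=0 .$$ *)

theory Defs
  imports "HOL-Analysis.Analysis"
begin

text \<open>
  An m x n real matrix has type \<open>real^'n^'m\<close>.  The factors \<open>U :: real^'r^'m\<close> and
  \<open>V :: real^'r^'n\<close> have \<open>column t U\<close> and \<open>column t V\<close> as the vectors \<open>u\<^sub>t\<close> and \<open>v\<^sub>t\<close>.  The index
  type \<open>'r\<close> carries a linear order because a sweep visits the columns in increasing order.
  On these types \<open>\<le>\<close> is the library's elementwise order and \<open>*\<close> is its elementwise
  (Hadamard) product; the matrix product is \<open>**\<close>.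
\<close>

definition pos_part :: "real^'n \<Rightarrow> real^'n" where
  "pos_part x = (\<chi> i. max (x $ i) 0)"

definition outer_prod :: "real^'m \<Rightarrow> real^'n \<Rightarrow> real^'n^'m" where
  "outer_prod u v = (\<chi> i j. u $ i * v $ j)"

definition set_column :: "'r \<Rightarrow> real^'m \<Rightarrow> real^'r^'m \<Rightarrow> real^'r^'m" where
  "set_column t x M = (\<chi> i j. if j = t then x $ i else M $ i $ j)"

definition rri_residue ::
  "real^'n^'m \<Rightarrow> 'r::finite \<Rightarrow> real^'r^'m \<Rightarrow> real^'r^'n \<Rightarrow> real^'n^'m" where
  "rri_residue A t U V = A - (\<Sum>i\<in>UNIV - {t}. outer_prod (column i U) (column i V))"

definition rri_step ::
  "real^'n^'m \<Rightarrow> 'r::finite \<Rightarrow> (real^'r^'m) \<times> (real^'r^'n) \<Rightarrow> (real^'r^'m) \<times> (real^'r^'n)" where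
  "rri_step A t = (\<lambda>(U, V).
     let R = rri_residue A t U V;
         u = column t U;
         p = pos_part (transpose R *v u);
         v' = (if p \<noteq> 0 then p /\<^sub>R (norm u)\<^sup>2 else 0);
         q = pos_part (R *v v');
         u' = (if q \<noteq> 0 then q /\<^sub>R (norm v')\<^sup>2 else 0)
     in (set_column t u' U, set_column t v' V))"

definition rri_sweep ::
  "real^'n^'m \<Rightarrow> (real^('r::{finite,linorder})^'m) \<times> (real^('r::{finite,linorder})^'n)
    \<Rightarrow> (real^('r::{finite,linorder})^'m) \<times> (real^('r::{finite,linorder})^'n)" where
  "rri_sweep A = fold (rri_step A) (sorted_list_of_set UNIV)"

definition rri_iterate ::
  "real^'n^'m \<Rightarrow> (real^('r::{finite,linorder})^'m) \<times> (real^('r::{finite,linorder})^'n)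
    \<Rightarrow> nat \<Rightarrow> (real^('r::{finite,linorder})^'m) \<times> (real^('r::{finite,linorder})^'n)" where
  "rri_iterate A UV0 k = (rri_sweep A ^^ k) UV0"

text \<open>
  The KKT conditions of minimizing \<open>1/2 \<parallel>A - U V\<^sup>T\<parallel>\<^sub>F\<^sup>2\<close> over nonnegative \<open>U\<close> and \<open>V\<close>.
\<close>

definition nmf_stationary_point ::
  "real^'n^'m \<Rightarrow> real^'r^'m \<Rightarrow> real^'r^'n \<Rightarrow> bool" where
  "nmf_stationary_point A U V \<longleftrightarrow>
     0 \<le> U \<and> 0 \<le> V \<and>
     0 \<le> U ** transpose V ** V - A ** V \<and>
     0 \<le> V ** transpose U ** U - transpose A ** U \<and>
     U * (U ** transpose V ** V - A ** V) = 0 \<and>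
     V * (V ** transpose U ** U - transpose A ** U) = 0"

definition seq_limit_point :: "(nat \<Rightarrow> 'a::topological_space) \<Rightarrow> 'a \<Rightarrow> bool" where
  "seq_limit_point X l \<longleftrightarrow> (\<exists>s::nat \<Rightarrow> nat. strict_mono s \<and> (X \<circ> s) \<longlonglongrightarrow> l)"

end

theory Submission
  imports Defs
begin

text \<open>
  Write \<open>E = A - U V\<^sup>T\<close> for the error and \<open>u, v\<close> for the columns that a step is about to replace by
  \<open>u', v'\<close>.  Each half of the step minimizes \<open>\<parallel>E\<parallel>\<^sup>2\<close> over one nonnegative column, and the objective is
  there a quadratic with Hessian a multiple of the identity.  The step therefore lowers \<open>\<parallel>E\<parallel>\<^sup>2\<close> by at
  least \<open>\<parallel>u\<parallel>\<^sup>2 \<parallel>v' - v\<parallel>\<^sup>2 + \<parallel>v'\<parallel>\<^sup>2 \<parallel>u' - u\<parallel>\<^sup>2\<close> (lemma \<open>rri_step_decrease\<close>).  As \<open>\<parallel>E\<parallel>\<^sup>2\<close> decreases and is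
  bounded below, \<open>\<parallel>u\<parallel> \<parallel>v' - v\<parallel>\<close> and \<open>\<parallel>v'\<parallel> \<parallel>u' - u\<parallel>\<close> tend to zero along the whole run.  These two products
  also bound the change of \<open>E\<close> in a step, so along a convergent subsequence of sweeps the error has
  the same limit at every intermediate stage of the sweep, although the factors themselves might
  not converge there.

  The update rules say \<open>\<parallel>u\<parallel>\<^sup>2 v' = [E\<^sup>T u + \<parallel>u\<parallel>\<^sup>2 v]\<^sub>+\<close> and \<open>\<parallel>v'\<parallel>\<^sup>2 u' = [E v' + (v \<bullet> v') u]\<^sub>+\<close>.  In the
  limit the primes disappear, and the resulting fixed-point equations of the projection are the
  KKT conditions of the two columns (lemma \<open>complementarity_if_projected_fixed_point\<close>).

  The only obstacle is that the second limit needs \<open>v' \<rightarrow> v\<close>, which follows from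
  \<open>\<parallel>u\<parallel> \<parallel>v' - v\<parallel> \<rightarrow> 0\<close> only if the limit of \<open>u\<close> is nonzero.  A step never shortens \<open>u\<close> unless it sets
  \<open>u\<close> to zero (lemma \<open>norm_ucol_le_norm_new_u\<close>), and then \<open>u\<close> and \<open>v\<close> stay zero forever.  So a zero limit
  of \<open>u\<close> forces a zero limit of \<open>v\<close>, and for such a pair the second condition is trivial.
\<close>

section \<open>Nonnegative vectors and rank-one matrices\<close>

text \<open>
  The products with a transposed matrix stay in the form \<open>transpose R *v u\<close>, in which the update of
  \<open>v\<close> mirrors the update of \<open>u\<close>.
\<close>

declare transpose_matrix_vector [simp del]

lemma pos_part_zero [simp]: "pos_part 0 = 0"
  by (simp add: pos_part_def vec_eq_iff)

lemma inner_pos_part_le: "0 \<le> x \<Longrightarrow> w \<bullet> x \<le> pos_part w \<bullet> x"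
  by (auto simp: inner_vec_def pos_part_def less_eq_vec_def intro!: sum_mono mult_right_mono)

lemma inner_pos_part_self: "w \<bullet> pos_part w = pos_part w \<bullet> pos_part w"
  unfolding inner_vec_def pos_part_def by (rule sum.cong) (auto simp: max_def)

lemma tendsto_pos_part:
  assumes "(f \<longlongrightarrow> w) F"
  shows "((\<lambda>k. pos_part (f k)) \<longlongrightarrow> pos_part w) F"
  unfolding pos_part_def by (intro tendsto_vec_lambda tendsto_max tendsto_vec_nth assms tendsto_const)

lemma transpose_mult_inner: "(transpose R *v u) \<bullet> v = u \<bullet> (R *v v)"
  for R :: "real^'n^'m"
  by (metis dot_lmul_matrix transpose_matrix_vector)

lemma outer_prod_diff_left: "outer_prod (x - y) v = outer_prod x v - outer_prod y v"
  and outer_prod_diff_right: "outer_prod u (a - b) = outer_prod u a - outer_prod u b"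
  by (simp_all add: outer_prod_def vec_eq_iff algebra_simps)

lemma inner_outer_prod: "R \<bullet> outer_prod u v = (transpose R *v u) \<bullet> v"
  unfolding transpose_mult_inner
  by (simp add: inner_vec_def outer_prod_def matrix_vector_mult_def sum_distrib_left mult_ac)

lemma outer_prod_mult_vec: "outer_prod u v *v x = (v \<bullet> x) *\<^sub>R u"
  by (simp add: vec_eq_iff inner_vec_def outer_prod_def matrix_vector_mult_def
      sum_distrib_left sum_distrib_right mult_ac)

lemma transpose_outer_prod: "transpose (outer_prod u v) = outer_prod v u"
  by (simp add: transpose_def outer_prod_def vec_eq_iff)

lemma norm_outer_prod: "norm (outer_prod u v) = norm u * norm v"
proof -
  have "(norm (outer_prod u v))\<^sup>2 = (norm u * norm v)\<^sup>2"
    unfolding power_mult_distrib unfolding power2_norm_eq_inner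
    unfolding inner_outer_prod transpose_outer_prod outer_prod_mult_vec by simp
  then show ?thesis
    by (simp add: power2_eq_iff_nonneg)
qed

lemma norm_diff_outer_prod:
  "(norm (R - outer_prod u v))\<^sup>2
    = (norm R)\<^sup>2 - 2 * ((transpose R *v u) \<bullet> v) + (norm u)\<^sup>2 * (norm v)\<^sup>2"
proof -
  have "(norm (R - outer_prod u v))\<^sup>2
      = (norm R)\<^sup>2 - 2 * (R \<bullet> outer_prod u v) + (norm (outer_prod u v))\<^sup>2"
    unfolding power2_norm_eq_inner by (simp add: inner_diff inner_commute)
  then show ?thesis
    by (simp add: inner_outer_prod norm_outer_prod power_mult_distrib)
qed

lemma transpose_diff: "transpose (A - B) = transpose A - transpose B"
  and transpose_add: "transpose (A + B) = transpose A + transpose B"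
  for A B :: "real^'n^'m"
  by (simp_all add: transpose_def vec_eq_iff)

lemma matrix_mult_transpose_eq_sum_outer_prod:
  "U ** transpose V = (\<Sum>i\<in>UNIV. outer_prod (column i U) (column i V))"
  by (simp add: vec_eq_iff matrix_matrix_mult_def transpose_def outer_prod_def column_def)

lemma tendsto_column:
  assumes "(f \<longlongrightarrow> M) F"
  shows "((\<lambda>k. column t (f k)) \<longlongrightarrow> column t M) F"
  unfolding column_def by (intro tendsto_vec_lambda tendsto_vec_nth assms)

lemma tendsto_transpose:
  fixes f :: "'a \<Rightarrow> real^'n^'m"
  assumes "(f \<longlongrightarrow> M) F"
  shows "((\<lambda>k. transpose (f k)) \<longlongrightarrow> transpose M) F"
  unfolding transpose_def by (intro tendsto_vec_lambda tendsto_vec_nth assms)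

lemma tendsto_matrix_vector_mult:
  fixes f :: "'a \<Rightarrow> real^'n^'m"
  assumes "(f \<longlongrightarrow> M) F" "(g \<longlongrightarrow> x) F"
  shows "((\<lambda>k. f k *v g k) \<longlongrightarrow> M *v x) F"
  unfolding matrix_vector_mult_def
  by (intro tendsto_vec_lambda tendsto_sum tendsto_mult tendsto_vec_nth assms)

lemma tendsto_outer_prod:
  assumes "(f \<longlongrightarrow> u) F" "(g \<longlongrightarrow> v) F"
  shows "((\<lambda>k. outer_prod (f k) (g k)) \<longlongrightarrow> outer_prod u v) F"
  unfolding outer_prod_def
  by (intro tendsto_vec_lambda tendsto_mult tendsto_vec_nth assms)

section \<open>Convex quadratics on the nonnegative orthant\<close>

text \<open>
  The point \<open>x'\<close> minimizes \<open>s \<parallel>x\<parallel>\<^sup>2 - 2 w \<bullet> x\<close> over the nonnegative orthant.  The gap to the minimum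
  exceeds \<open>s \<parallel>x' - x\<parallel>\<^sup>2\<close> by twice \<open>(s x' - w) \<bullet> (x - x')\<close>, which is nonnegative by the variational
  inequality at \<open>x'\<close>.  With both assumptions on \<open>x'\<close> the degenerate case \<open>s = 0\<close> is included: it then
  forces \<open>pos_part w = 0\<close>.
\<close>

lemma nonneg_quadratic_decrease:
  fixes w x :: "real^'n"
  assumes "0 \<le> x" and x': "x' = pos_part w /\<^sub>R s" and s: "s *\<^sub>R x' = pos_part w"
  shows "s * (norm (x' - x))\<^sup>2
    \<le> (s * (norm x)\<^sup>2 - 2 * (w \<bullet> x)) - (s * (norm x')\<^sup>2 - 2 * (w \<bullet> x'))"
proof -
  have "(pos_part w - w) \<bullet> x' = 0"
    by (simp add: x' inner_diff_left inner_pos_part_self)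
  moreover have "(pos_part w - w) \<bullet> x \<ge> 0"
    using inner_pos_part_le[OF \<open>0 \<le> x\<close>, of w] by (simp add: inner_diff_left)
  ultimately have "(s *\<^sub>R x' - w) \<bullet> (x - x') \<ge> 0"
    by (simp add: s inner_diff_right)
  then show ?thesis
    by (simp add: power2_norm_eq_inner inner_diff inner_commute[of x x'] algebra_simps)
qed

text \<open>
  In each coordinate, \<open>s x = max (w + s x) 0\<close> leaves two cases: either the maximum is the first term
  and \<open>w = 0\<close>, or it is zero and then \<open>s x = 0\<close> and \<open>w \<le> 0\<close>.  For \<open>s = 0\<close> the equation leaves \<open>x\<close>
  undetermined, and complementarity has to come from \<open>w\<close>.
\<close>

lemma complementarity_if_projected_fixed_point:
  fixes w x :: "real^'n"
  assumes fp: "s *\<^sub>R x = pos_part (w + s *\<^sub>R x)" and "s = 0 \<Longrightarrow> w = 0"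
  shows "w \<le> 0 \<and> x * w = 0"
proof -
  have "w $ i \<le> 0 \<and> x $ i * w $ i = 0" for i
  proof -
    have "s * x $ i = max (w $ i + s * x $ i) 0"
      using arg_cong[OF fp, of "\<lambda>y. y $ i"] by (simp add: pos_part_def)
    then have "w $ i \<le> 0" "w $ i = 0 \<or> s * x $ i = 0"
      by (auto simp: max_def split: if_splits)
    then show ?thesis
      using assms(2) by auto
  qed
  then show ?thesis
    by (simp add: less_eq_vec_def vec_eq_iff)
qed

section \<open>A single step\<close>

definition nmf_error ::
  "real^'n^'m \<Rightarrow> (real^'r^'m) \<times> (real^'r^'n) \<Rightarrow> real^'n^'m" where
  "nmf_error A Z = A - fst Z ** transpose (snd Z)"

abbreviation ucol :: "'r \<Rightarrow> (real^'r^'m) \<times> (real^'r^'n) \<Rightarrow> real^'m" where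
  "ucol t Z \<equiv> column t (fst Z)"

abbreviation vcol :: "'r \<Rightarrow> (real^'r^'m) \<times> (real^'r^'n) \<Rightarrow> real^'n" where
  "vcol t Z \<equiv> column t (snd Z)"

definition nonneg_pair :: "(real^'r^'m) \<times> (real^'r^'n) \<Rightarrow> bool" where
  "nonneg_pair Z \<longleftrightarrow> 0 \<le> fst Z \<and> 0 \<le> snd Z"

text \<open>
  This is the residue matrix of the algorithm in a form that refers to the error, the only matrix
  whose limit is controlled during a sweep.
\<close>

definition residue :: "real^'n^'m \<Rightarrow> 'r \<Rightarrow> (real^'r^'m) \<times> (real^'r^'n) \<Rightarrow> real^'n^'m" where
  "residue A t Z = nmf_error A Z + outer_prod (ucol t Z) (vcol t Z)"

text \<open>
  The case distinctions of the algorithm disappear in the next two definitions: scaling a zero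
  vector gives zero, and the divisor vanishes only together with the vector that it divides.
\<close>

definition new_v :: "real^'n^'m \<Rightarrow> 'r \<Rightarrow> (real^'r^'m) \<times> (real^'r^'n) \<Rightarrow> real^'n" where
  "new_v A t Z = pos_part (transpose (residue A t Z) *v ucol t Z) /\<^sub>R (norm (ucol t Z))\<^sup>2"

definition new_u :: "real^'n^'m \<Rightarrow> 'r \<Rightarrow> (real^'r^'m) \<times> (real^'r^'n) \<Rightarrow> real^'m" where
  "new_u A t Z = pos_part (residue A t Z *v new_v A t Z) /\<^sub>R (norm (new_v A t Z))\<^sup>2"

lemma rri_residue_eq: "rri_residue A t (fst Z) (snd Z) = residue A t Z"
  by (simp add: rri_residue_def residue_def nmf_error_def
      matrix_mult_transpose_eq_sum_outer_prod sum.remove[of UNIV t])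

lemma rri_step_eq:
  "rri_step A t Z = (set_column t (new_u A t Z) (fst Z), set_column t (new_v A t Z) (snd Z))"
proof -
  have if_zero: "(if p \<noteq> 0 then p /\<^sub>R c else 0) = p /\<^sub>R c" for p :: "real^'k" and c
    by simp
  show ?thesis
    by (simp only: rri_step_def case_prod_unfold Let_def if_zero rri_residue_eq new_u_def new_v_def)
qed

lemma column_set_column: "column i (set_column t x M) = (if i = t then x else column i M)"
  by (simp add: column_def set_column_def vec_eq_iff)

lemma ucol_rri_step: "ucol i (rri_step A t Z) = (if i = t then new_u A t Z else ucol i Z)"
  and vcol_rri_step: "vcol i (rri_step A t Z) = (if i = t then new_v A t Z else vcol i Z)"
  by (simp_all add: rri_step_eq column_set_column)

lemma residue_rri_step: "residue A t (rri_step A t Z) = residue A t Z"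
  unfolding rri_residue_eq[symmetric] rri_residue_def
  by (simp add: ucol_rri_step vcol_rri_step)

lemma nmf_error_eq: "nmf_error A Z = residue A t Z - outer_prod (ucol t Z) (vcol t Z)"
  by (simp add: residue_def)

lemma nmf_error_rri_step:
  "nmf_error A (rri_step A t Z) = residue A t Z - outer_prod (new_u A t Z) (new_v A t Z)"
  by (simp add: nmf_error_eq[of A _ t] residue_rri_step ucol_rri_step vcol_rri_step)

lemma scale_new_v:
  "(norm (ucol t Z))\<^sup>2 *\<^sub>R new_v A t Z = pos_part (transpose (residue A t Z) *v ucol t Z)"
  by (cases "ucol t Z = 0") (simp_all add: new_v_def)

lemma scale_new_u:
  "(norm (new_v A t Z))\<^sup>2 *\<^sub>R new_u A t Z = pos_part (residue A t Z *v new_v A t Z)"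
  by (cases "new_v A t Z = 0") (simp_all add: new_u_def)

lemma nonneg_iff_columns: "0 \<le> M \<longleftrightarrow> (\<forall>t. 0 \<le> column t M)"
  for M :: "real^'r^'m"
  by (auto simp: less_eq_vec_def column_def)

lemma new_v_nonneg: "0 \<le> new_v A t Z"
  and new_u_nonneg: "0 \<le> new_u A t Z"
  by (simp_all add: new_v_def new_u_def less_eq_vec_def pos_part_def)

lemma nonneg_pair_rri_step: "nonneg_pair Z \<Longrightarrow> nonneg_pair (rri_step A t Z)"
  unfolding nonneg_pair_def nonneg_iff_columns
  by (auto simp: ucol_rri_step vcol_rri_step new_v_nonneg new_u_nonneg)

text \<open>
  Both halves of the step are instances of \<open>nonneg_quadratic_decrease\<close>, because
  \<open>\<parallel>R - u v\<^sup>T\<parallel>\<^sup>2\<close> is a quadratic of that form in \<open>v\<close> for fixed \<open>u\<close> and in \<open>u\<close> for fixed \<open>v\<close>.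
\<close>

lemma rri_step_decrease:
  assumes "nonneg_pair Z"
  shows "(norm (ucol t Z))\<^sup>2 * (norm (new_v A t Z - vcol t Z))\<^sup>2
      + (norm (new_v A t Z))\<^sup>2 * (norm (new_u A t Z - ucol t Z))\<^sup>2
    \<le> (norm (nmf_error A Z))\<^sup>2 - (norm (nmf_error A (rri_step A t Z)))\<^sup>2"
proof -
  let ?R = "residue A t Z" and ?u = "ucol t Z" and ?v = "vcol t Z"
    and ?u' = "new_u A t Z" and ?v' = "new_v A t Z"
  have nonneg: "0 \<le> ?u" "0 \<le> ?v"
    using assms unfolding nonneg_pair_def nonneg_iff_columns by auto
  have "(norm ?u)\<^sup>2 * (norm (?v' - ?v))\<^sup>2
      \<le> (norm (?R - outer_prod ?u ?v))\<^sup>2 - (norm (?R - outer_prod ?u ?v'))\<^sup>2"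
    using nonneg_quadratic_decrease[OF nonneg(2) new_v_def[of A t Z] scale_new_v]
    by (simp add: norm_diff_outer_prod)
  moreover have "(norm ?v')\<^sup>2 * (norm (?u' - ?u))\<^sup>2
      \<le> (norm (?R - outer_prod ?u ?v'))\<^sup>2 - (norm (?R - outer_prod ?u' ?v'))\<^sup>2"
    using nonneg_quadratic_decrease[OF nonneg(1) new_u_def[of A t Z] scale_new_u]
    by (simp add: norm_diff_outer_prod transpose_mult_inner inner_commute[of "?R *v ?v'"]
        mult.commute)
  ultimately show ?thesis
    by (simp add: nmf_error_rri_step nmf_error_eq[of A Z t])
qed

text \<open>
  Both update rules evaluate the bilinear form \<open>u \<bullet> R v'\<close>: the first gives
  \<open>u \<bullet> R v' = \<parallel>u\<parallel>\<^sup>2 \<parallel>v'\<parallel>\<^sup>2\<close>, and the second gives \<open>u \<bullet> R v' \<le> \<parallel>v'\<parallel>\<^sup>2 (u' \<bullet> u)\<close> as \<open>u\<close> is nonnegative.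
  Cauchy-Schwarz then compares \<open>\<parallel>u\<parallel>\<close> with \<open>\<parallel>u'\<parallel>\<close>.
\<close>

lemma norm_ucol_le_norm_new_u:
  assumes "nonneg_pair Z" "new_u A t Z \<noteq> 0"
  shows "norm (ucol t Z) \<le> norm (new_u A t Z)"
proof -
  let ?R = "residue A t Z" and ?u = "ucol t Z" and ?u' = "new_u A t Z" and ?v' = "new_v A t Z"
  have "0 \<le> ?u"
    using assms unfolding nonneg_pair_def nonneg_iff_columns by auto
  have v': "?v' \<noteq> 0"
    using assms(2) by (auto simp: new_u_def)
  have "(norm ?v')\<^sup>2 * (norm ?u)\<^sup>2 = ?v' \<bullet> ((norm ?u)\<^sup>2 *\<^sub>R ?v')"
    by (simp add: power2_norm_eq_inner)
  also have "\<dots> = (transpose ?R *v ?u) \<bullet> ?v'"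
    unfolding scale_new_v by (simp add: new_v_def inner_pos_part_self)
  also have "\<dots> = (?R *v ?v') \<bullet> ?u"
    by (metis transpose_mult_inner inner_commute)
  also have "\<dots> \<le> (norm ?v')\<^sup>2 * (?u' \<bullet> ?u)"
    using inner_pos_part_le[OF \<open>0 \<le> ?u\<close>, of "?R *v ?v'"] by (simp flip: scale_new_u)
  finally have "(norm ?u)\<^sup>2 \<le> ?u' \<bullet> ?u"
    using v' by simp
  also have "\<dots> \<le> norm ?u' * norm ?u"
    by (rule norm_cauchy_schwarz)
  finally show ?thesis
    by (cases "?u = 0") (simp_all add: power2_eq_square)
qed

text \<open>
  The change of the rank-one term is \<open>u' v'\<^sup>T - u v\<^sup>T = u (v' - v)\<^sup>T + (u' - u) v'\<^sup>T\<close>, so it is controlled by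
  exactly the two quantities whose squares appear in \<open>rri_step_decrease\<close>.
\<close>

lemma nmf_error_step_diff:
  "norm (nmf_error A (rri_step A t Z) - nmf_error A Z)
    \<le> norm (ucol t Z) * norm (new_v A t Z - vcol t Z)
      + norm (new_v A t Z) * norm (new_u A t Z - ucol t Z)"
proof -
  have "nmf_error A Z - nmf_error A (rri_step A t Z)
      = outer_prod (ucol t Z) (new_v A t Z - vcol t Z)
        + outer_prod (new_u A t Z - ucol t Z) (new_v A t Z)"
    by (simp add: nmf_error_rri_step nmf_error_eq[of A Z t]
        outer_prod_diff_left outer_prod_diff_right)
  then have "norm (nmf_error A Z - nmf_error A (rri_step A t Z))
      \<le> norm (ucol t Z) * norm (new_v A t Z - vcol t Z)
        + norm (new_u A t Z - ucol t Z) * norm (new_v A t Z)"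
    by (metis norm_outer_prod norm_triangle_ineq)
  then show ?thesis
    by (simp add: norm_minus_commute mult.commute)
qed

section \<open>A sweep\<close>

lemma nonneg_pair_fold: "nonneg_pair Z \<Longrightarrow> nonneg_pair (fold (rri_step A) ts Z)"
  by (induction ts arbitrary: Z) (simp_all add: nonneg_pair_rri_step)

lemma ucol_fold: "t \<notin> set ts \<Longrightarrow> ucol t (fold (rri_step A) ts Z) = ucol t Z"
  and vcol_fold: "t \<notin> set ts \<Longrightarrow> vcol t (fold (rri_step A) ts Z) = vcol t Z"
  by (induction ts arbitrary: Z) (auto simp: ucol_rri_step vcol_rri_step)

lemma norm_nmf_error_fold_le:
  "nonneg_pair Z \<Longrightarrow> norm (nmf_error A (fold (rri_step A) ts Z)) \<le> norm (nmf_error A Z)"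
proof (induction ts arbitrary: Z)
  case (Cons t ts)
  have "0 \<le> (norm (nmf_error A Z))\<^sup>2 - (norm (nmf_error A (rri_step A t Z)))\<^sup>2"
    by (rule order_trans[OF _ rri_step_decrease[OF Cons.prems]]) simp
  then have "norm (nmf_error A (rri_step A t Z)) \<le> norm (nmf_error A Z)"
    using power2_le_imp_le[OF _ norm_ge_zero] by simp
  with Cons.IH[OF nonneg_pair_rri_step[OF Cons.prems], of A t] show ?case
    by (simp add: order_trans)
qed simp

text \<open>
  A sweep visits each column once, so column \<open>t\<close> is still in its initial state when its step comes
  and keeps the outcome of that step until the end of the sweep.
\<close>

lemma sweep_split:
  fixes t :: "'r::{finite,linorder}"
  obtains pre post where "sorted_list_of_set UNIV = pre @ t # post" "t \<notin> set pre" "t \<notin> set post"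
proof -
  have "t \<in> set (sorted_list_of_set UNIV)"
    by simp
  from split_list[OF this] obtain pre post
    where split: "sorted_list_of_set UNIV = pre @ t # post"
    by blast
  have "distinct (pre @ t # post)"
    unfolding split[symmetric] by (rule distinct_sorted_list_of_set)
  then have "t \<notin> set pre" "t \<notin> set post"
    by simp_all
  with split show thesis
    by (rule that)
qed

section \<open>Limits along the iteration\<close>

locale rri_run =
  fixes A :: "real^'n^'m" and X :: "nat \<Rightarrow> (real^('r::{finite,linorder})^'m) \<times> (real^('r::{finite,linorder})^'n)"
  assumes nonneg_start: "nonneg_pair (X 0)"
    and sweep: "\<And>k. X (Suc k) = rri_sweep A (X k)"
begin

lemma nonneg: "nonneg_pair (X k)"
  by (induction k) (simp_all add: nonneg_start sweep rri_sweep_def nonneg_pair_fold)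

lemma norm_error_le_within_sweep:
  assumes "sorted_list_of_set UNIV = ts @ ts'"
  shows "norm (nmf_error A (X (Suc k))) \<le> norm (nmf_error A (fold (rri_step A) ts (X k)))"
  unfolding sweep rri_sweep_def assms fold_append o_apply
  by (intro norm_nmf_error_fold_le nonneg_pair_fold nonneg)

lemma norm_error_convergent: "convergent (\<lambda>k. (norm (nmf_error A (X k)))\<^sup>2)"
proof -
  have "decseq (\<lambda>k. (norm (nmf_error A (X k)))\<^sup>2)"
    by (intro decseq_SucI power_mono)
       (use norm_error_le_within_sweep[of "[]"] in \<open>simp_all del: sorted_list_of_set_eq_Nil_iff\<close>)
  from decseq_convergent[OF this, of 0] show ?thesis
    by (auto simp: convergent_def)
qed

text \<open>
  The decrease in one step is at most the decrease over the sweep that contains it, which tends to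
  zero because the errors of the sweeps converge.
\<close>

lemma step_changes_vanish:
  assumes split: "sorted_list_of_set UNIV = ts @ t # ts'"
  defines "Z \<equiv> \<lambda>k. fold (rri_step A) ts (X k)"
  shows "(\<lambda>k. norm (ucol t (Z k)) * norm (new_v A t (Z k) - vcol t (Z k))) \<longlonglongrightarrow> 0"
    and "(\<lambda>k. norm (new_v A t (Z k)) * norm (new_u A t (Z k) - ucol t (Z k))) \<longlonglongrightarrow> 0"
proof -
  let ?f = "\<lambda>k. (norm (nmf_error A (X k)))\<^sup>2"
  let ?a = "\<lambda>k. norm (ucol t (Z k)) * norm (new_v A t (Z k) - vcol t (Z k))"
  let ?b = "\<lambda>k. norm (new_v A t (Z k)) * norm (new_u A t (Z k) - ucol t (Z k))"
  obtain c where c: "?f \<longlonglongrightarrow> c"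
    using norm_error_convergent by (auto simp: convergent_def)
  have "(\<lambda>k. ?f k - ?f (Suc k)) \<longlonglongrightarrow> 0"
    using tendsto_diff[OF c LIMSEQ_Suc[OF c]] by simp
  then have lim: "(\<lambda>k. sqrt (?f k - ?f (Suc k))) \<longlonglongrightarrow> 0"
    using tendsto_real_sqrt by force
  have bound: "(?a k)\<^sup>2 + (?b k)\<^sup>2 \<le> ?f k - ?f (Suc k)" for k
  proof -
    have "(?a k)\<^sup>2 + (?b k)\<^sup>2 \<le> (norm (nmf_error A (Z k)))\<^sup>2 - (norm (nmf_error A (rri_step A t (Z k))))\<^sup>2"
      using rri_step_decrease[of "Z k" t A] nonneg_pair_fold[OF nonneg]
      by (simp add: Z_def power_mult_distrib)
    moreover have "norm (nmf_error A (Z k)) \<le> norm (nmf_error A (X k))"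
      unfolding Z_def by (rule norm_nmf_error_fold_le[OF nonneg])
    moreover have "norm (nmf_error A (X (Suc k))) \<le> norm (nmf_error A (rri_step A t (Z k)))"
      using norm_error_le_within_sweep[of "ts @ [t]" ts'] split by (simp add: Z_def)
    ultimately show ?thesis
      by (smt (verit) norm_ge_zero power_mono)
  qed
  have "(?a k)\<^sup>2 \<le> ?f k - ?f (Suc k)" "(?b k)\<^sup>2 \<le> ?f k - ?f (Suc k)" for k
    using bound[of k] zero_le_power2[of "?a k"] zero_le_power2[of "?b k"] by linarith+
  then have "norm (?a k) \<le> sqrt (?f k - ?f (Suc k))" "norm (?b k) \<le> sqrt (?f k - ?f (Suc k))" for k
    by (simp_all add: real_le_rsqrt)
  then show "?a \<longlonglongrightarrow> 0" "?b \<longlonglongrightarrow> 0"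
    by (auto intro: Lim_null_comparison[OF always_eventually lim])
qed

lemma error_change_within_sweep_vanishes:
  assumes "sorted_list_of_set UNIV = ts @ ts'"
  shows "(\<lambda>k. nmf_error A (fold (rri_step A) ts (X k)) - nmf_error A (X k)) \<longlonglongrightarrow> 0"
  using assms
proof (induction ts arbitrary: ts' rule: rev_induct)
  case (snoc t ts)
  let ?Z = "\<lambda>k. fold (rri_step A) ts (X k)"
  have split: "sorted_list_of_set UNIV = ts @ t # ts'"
    using snoc.prems by simp
  have "(\<lambda>k. nmf_error A (rri_step A t (?Z k)) - nmf_error A (?Z k)) \<longlonglongrightarrow> 0"
    by (rule Lim_null_comparison[OF always_eventually
          tendsto_add_zero[OF step_changes_vanish[OF split]]])
       (intro allI nmf_error_step_diff)
  from tendsto_add_zero[OF this snoc.IH[OF split]] show ?case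
    by simp
qed simp

lemma dead_column:
  assumes "ucol t (X K) = 0" "k > K"
  shows "ucol t (X k) = 0 \<and> vcol t (X k) = 0"
proof -
  obtain pre post where split: "sorted_list_of_set UNIV = pre @ t # post" "t \<notin> set pre" "t \<notin> set post"
    by (rule sweep_split)
  have step: "ucol t (X (Suc k)) = 0 \<and> vcol t (X (Suc k)) = 0" if "ucol t (X k) = 0" for k
    using split that
    by (simp add: sweep rri_sweep_def ucol_fold vcol_fold ucol_rri_step vcol_rri_step
        new_v_def new_u_def)
  show ?thesis
    using assms(2) by (induction k) (use assms(1) step in \<open>auto simp: less_Suc_eq\<close>)
qed

lemma norm_ucol_mono_if_alive:
  assumes "\<And>k. ucol t (X k) \<noteq> 0"
  shows "norm (ucol t (X 0)) \<le> norm (ucol t (X k))"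
proof (induction k)
  case (Suc k)
  obtain pre post where split: "sorted_list_of_set UNIV = pre @ t # post" "t \<notin> set pre" "t \<notin> set post"
    by (rule sweep_split)
  let ?Z = "fold (rri_step A) pre (X k)"
  have u: "ucol t (X (Suc k)) = new_u A t ?Z"
    using split by (simp add: sweep rri_sweep_def ucol_fold ucol_rri_step)
  have "norm (ucol t (X k)) \<le> norm (ucol t (X (Suc k)))"
    using norm_ucol_le_norm_new_u[OF nonneg_pair_fold[OF nonneg], of A t A pre k]
      assms[of "Suc k"] split unfolding u by (simp add: ucol_fold)
  with Suc show ?case
    by simp
qed simp

text \<open>
  If the column \<open>u\<close> is never zero, its norm is at least its initial norm and the limit is not zero.
  Otherwise it is zero at some time, and both columns are zero from the next sweep on.
\<close>

lemma vcol_limit_eq_0_if_ucol_limit_eq_0: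
  assumes "strict_mono s" "(\<lambda>j. ucol t (X (s j))) \<longlonglongrightarrow> 0" "(\<lambda>j. vcol t (X (s j))) \<longlonglongrightarrow> v"
  shows "v = 0"
proof (cases "\<exists>K. ucol t (X K) = 0")
  case True
  then obtain K where "ucol t (X K) = 0"
    by blast
  then have "vcol t (X (s j)) = 0" if "j > K" for j
    using dead_column[of t K "s j"] seq_suble[OF assms(1), of j] that by simp
  then have "(\<lambda>j. vcol t (X (s j))) \<longlonglongrightarrow> 0"
    by (intro tendsto_eventually eventually_mono[OF eventually_gt_at_top[of K]])
  with assms(3) show ?thesis
    by (rule LIMSEQ_unique)
next
  case False
  then have "norm (ucol t (X 0)) \<le> 0"
    using norm_ucol_mono_if_alive
    by (intro tendsto_lowerbound[OF tendsto_norm_zero[OF assms(2)]]) auto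
  with False show ?thesis
    by simp
qed

text \<open>
  The update rules for column \<open>t\<close> are followed along the subsequence, at the stage \<open>Z\<close> just before the
  step of that column.
\<close>

lemma column_stationarity:
  assumes s: "strict_mono s" and lim: "(\<lambda>j. X (s j)) \<longlonglongrightarrow> L"
  shows "transpose (nmf_error A L) *v ucol t L \<le> 0 \<and>
      vcol t L * (transpose (nmf_error A L) *v ucol t L) = 0"
    and "nmf_error A L *v vcol t L \<le> 0 \<and> ucol t L * (nmf_error A L *v vcol t L) = 0"
proof -
  obtain pre post where split: "sorted_list_of_set UNIV = pre @ t # post" "t \<notin> set pre" "t \<notin> set post"
    by (rule sweep_split)
  define Z where "Z = (\<lambda>j. fold (rri_step A) pre (X (s j)))"
  define v' where "v' = (\<lambda>j. new_v A t (Z j))"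
  define u' where "u' = (\<lambda>j. new_u A t (Z j))"
  let ?E = "nmf_error A L" and ?u = "ucol t L" and ?v = "vcol t L"
  have cols: "ucol t (Z j) = ucol t (X (s j))" "vcol t (Z j) = vcol t (X (s j))" for j
    using split by (simp_all add: Z_def ucol_fold vcol_fold)
  have u: "(\<lambda>j. ucol t (Z j)) \<longlonglongrightarrow> ?u" and v: "(\<lambda>j. vcol t (Z j)) \<longlonglongrightarrow> ?v"
    unfolding cols by (intro tendsto_column tendsto_fst tendsto_snd lim)+
  have "(\<lambda>j. nmf_error A (X (s j))) \<longlonglongrightarrow> ?E"
    unfolding nmf_error_def matrix_mult_transpose_eq_sum_outer_prod
    by (intro tendsto_diff tendsto_const tendsto_sum tendsto_outer_prod tendsto_column
        tendsto_fst tendsto_snd lim)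
  moreover have "(\<lambda>j. nmf_error A (Z j) - nmf_error A (X (s j))) \<longlonglongrightarrow> 0"
    using LIMSEQ_subseq_LIMSEQ[OF error_change_within_sweep_vanishes[OF split(1)] s]
    by (simp add: o_def Z_def)
  ultimately have E: "(\<lambda>j. nmf_error A (Z j)) \<longlonglongrightarrow> ?E"
    by (rule Lim_transform)
  have R: "(\<lambda>j. residue A t (Z j)) \<longlonglongrightarrow> ?E + outer_prod ?u ?v"
    unfolding residue_def by (intro tendsto_add E tendsto_outer_prod u v)
  have dv: "(\<lambda>j. norm (ucol t (Z j)) * norm (v' j - vcol t (Z j))) \<longlonglongrightarrow> 0"
    and du: "(\<lambda>j. norm (v' j) * norm (u' j - ucol t (Z j))) \<longlonglongrightarrow> 0"
    using step_changes_vanish[OF split(1), THEN LIMSEQ_subseq_LIMSEQ, OF s]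
    by (simp_all add: o_def Z_def v'_def u'_def)
  \<comment> \<open>The new value \<open>y\<close> may fail to converge where \<open>c\<close> tends to zero, but \<open>\<parallel>c\<parallel>\<^sup>2 y\<close> has the limit that the
     old value \<open>x\<close> would give.\<close>
  have scaled_limit: "(\<lambda>j. (norm (c j))\<^sup>2 *\<^sub>R y j) \<longlonglongrightarrow> (norm c0)\<^sup>2 *\<^sub>R x0"
    if "c \<longlonglongrightarrow> c0" "x \<longlonglongrightarrow> x0" "(\<lambda>j. norm (c j) * norm (y j - x j)) \<longlonglongrightarrow> 0"
    for c :: "nat \<Rightarrow> real^'k" and c0 and x y :: "nat \<Rightarrow> real^'l" and x0
  proof -
    have "(\<lambda>j. norm (c j) * (norm (c j) * norm (y j - x j))) \<longlonglongrightarrow> norm c0 * 0"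
      by (intro tendsto_mult tendsto_norm that)
    then have "(\<lambda>j. (norm (c j))\<^sup>2 *\<^sub>R (y j - x j)) \<longlonglongrightarrow> 0"
      by - (rule tendsto_norm_zero_cancel, simp add: power2_eq_square mult.assoc)
    moreover have "(\<lambda>j. (norm (c j))\<^sup>2 *\<^sub>R x j) \<longlonglongrightarrow> (norm c0)\<^sup>2 *\<^sub>R x0"
      by (intro tendsto_scaleR tendsto_power tendsto_norm that)
    ultimately have "(\<lambda>j. (norm (c j))\<^sup>2 *\<^sub>R (y j - x j) + (norm (c j))\<^sup>2 *\<^sub>R x j)
        \<longlonglongrightarrow> 0 + (norm c0)\<^sup>2 *\<^sub>R x0"
      by (rule tendsto_add)
    then show ?thesis
      by (simp add: scaleR_diff_right)
  qed
  have "(norm ?u)\<^sup>2 *\<^sub>R ?v = pos_part (transpose (?E + outer_prod ?u ?v) *v ?u)"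
  proof (rule LIMSEQ_unique)
    show "(\<lambda>j. (norm (ucol t (Z j)))\<^sup>2 *\<^sub>R v' j) \<longlonglongrightarrow> (norm ?u)\<^sup>2 *\<^sub>R ?v"
      by (rule scaled_limit[OF u v dv])
    show "(\<lambda>j. (norm (ucol t (Z j)))\<^sup>2 *\<^sub>R v' j) \<longlonglongrightarrow>
        pos_part (transpose (?E + outer_prod ?u ?v) *v ?u)"
      unfolding v'_def scale_new_v
      by (intro tendsto_pos_part tendsto_matrix_vector_mult tendsto_transpose R u)
  qed
  also have "transpose (?E + outer_prod ?u ?v) *v ?u = transpose ?E *v ?u + (norm ?u)\<^sup>2 *\<^sub>R ?v"
    by (simp add: transpose_add transpose_outer_prod matrix_vector_mult_add_rdistrib
        outer_prod_mult_vec power2_norm_eq_inner)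
  finally show "transpose ?E *v ?u \<le> 0 \<and> ?v * (transpose ?E *v ?u) = 0"
    by (rule complementarity_if_projected_fixed_point) simp
  show "?E *v ?v \<le> 0 \<and> ?u * (?E *v ?v) = 0"
  proof (cases "?u = 0")
    case True
    have "?v = 0"
      by (rule vcol_limit_eq_0_if_ucol_limit_eq_0[OF s])
         (use u v True in \<open>simp_all add: cols\<close>)
    then show ?thesis
      by simp
  next
    case False
    have "(\<lambda>j. (norm (ucol t (Z j)) * norm (v' j - vcol t (Z j))) / norm (ucol t (Z j)))
        \<longlonglongrightarrow> 0 / norm ?u"
      using False by (intro tendsto_divide dv tendsto_norm u) simp
    moreover have "\<forall>\<^sub>F j in sequentially. ucol t (Z j) \<noteq> 0"
      using u False by (rule tendsto_imp_eventually_ne)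
    ultimately have "(\<lambda>j. norm (v' j - vcol t (Z j))) \<longlonglongrightarrow> 0"
      by (auto elim!: Lim_transform_eventually eventually_mono)
    then have v': "v' \<longlonglongrightarrow> ?v"
      by (rule Lim_transform[OF v tendsto_norm_zero_cancel])
    have "(norm ?v)\<^sup>2 *\<^sub>R ?u = pos_part ((?E + outer_prod ?u ?v) *v ?v)"
    proof (rule LIMSEQ_unique)
      show "(\<lambda>j. (norm (v' j))\<^sup>2 *\<^sub>R u' j) \<longlonglongrightarrow> (norm ?v)\<^sup>2 *\<^sub>R ?u"
        by (rule scaled_limit[OF v' u du])
      have "(\<lambda>j. pos_part (residue A t (Z j) *v v' j)) \<longlonglongrightarrow> pos_part ((?E + outer_prod ?u ?v) *v ?v)"
        by (intro tendsto_pos_part tendsto_matrix_vector_mult R v')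
      then show "(\<lambda>j. (norm (v' j))\<^sup>2 *\<^sub>R u' j) \<longlonglongrightarrow> pos_part ((?E + outer_prod ?u ?v) *v ?v)"
        unfolding v'_def u'_def scale_new_u .
    qed
    also have "(?E + outer_prod ?u ?v) *v ?v = ?E *v ?v + (norm ?v)\<^sup>2 *\<^sub>R ?u"
      by (simp add: matrix_vector_mult_add_rdistrib outer_prod_mult_vec power2_norm_eq_inner)
    finally show ?thesis
      by (rule complementarity_if_projected_fixed_point) simp
  qed
qed

end

section \<open>Limit points are stationary\<close>

lemma column_matrix_mult: "column t (M ** V) = M *v column t V"
  by (simp add: vec_eq_iff column_def matrix_matrix_mult_def matrix_vector_mult_def)

text \<open>
  The two gradients in the KKT conditions are \<open>- E V\<close> and \<open>- E\<^sup>T U\<close>, and they act on each column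
  separately.
\<close>

lemma nmf_stationary_point_if_columns:
  assumes "nonneg_pair L"
    and u: "\<And>t. nmf_error A L *v vcol t L \<le> 0 \<and> ucol t L * (nmf_error A L *v vcol t L) = 0"
    and v: "\<And>t. transpose (nmf_error A L) *v ucol t L \<le> 0 \<and>
      vcol t L * (transpose (nmf_error A L) *v ucol t L) = 0"
  shows "nmf_stationary_point A (fst L) (snd L)"
proof -
  have kkt: "0 \<le> - M \<and> W * (- M) = 0"
    if "\<And>t. column t M \<le> 0 \<and> column t W * column t M = 0" for M W :: "real^'k^'l"
    using that by (auto simp: less_eq_vec_def vec_eq_iff column_def)
  have gradU: "fst L ** transpose (snd L) ** snd L - A ** snd L = - (nmf_error A L ** snd L)"
    by (simp add: nmf_error_def vec_eq_iff matrix_matrix_mult_def left_diff_distrib sum_subtractf)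
  have "transpose (nmf_error A L) = transpose A - snd L ** transpose (fst L)"
    by (simp add: nmf_error_def transpose_diff matrix_transpose_mul)
  then have gradV: "snd L ** transpose (fst L) ** fst L - transpose A ** fst L
      = - (transpose (nmf_error A L) ** fst L)"
    by (simp add: vec_eq_iff matrix_matrix_mult_def left_diff_distrib sum_subtractf)
  show ?thesis
    unfolding nmf_stationary_point_def gradU gradV
    using assms(1) kkt[of "nmf_error A L ** snd L" "fst L"]
      kkt[of "transpose (nmf_error A L) ** fst L" "snd L"] u v
    by (auto simp: nonneg_pair_def column_matrix_mult)
qed

theorem theorem5p1:
  fixes A :: "real^'n^'m"
    and U0 :: "real^('r::{finite,linorder})^'m"
    and V0 :: "real^('r::{finite,linorder})^'n"
    and Ulim :: "real^('r::{finite,linorder})^'m"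
    and Vlim :: "real^('r::{finite,linorder})^'n"
  assumes "0 \<le> A"
    and "0 \<le> U0"
    and "0 \<le> V0"
    and "seq_limit_point (rri_iterate A (U0, V0)) (Ulim, Vlim)"
  shows "nmf_stationary_point A Ulim Vlim"
proof -
  let ?X = "rri_iterate A (U0, V0)" and ?L = "(Ulim, Vlim)"
  interpret rri_run A ?X
    by unfold_locales (use assms(2,3) in \<open>auto simp: rri_iterate_def nonneg_pair_def\<close>)
  obtain s where s: "strict_mono s" and lim: "(\<lambda>j. ?X (s j)) \<longlonglongrightarrow> ?L"
    using assms(4) by (auto simp: seq_limit_point_def o_def)
  have nonneg_limit: "0 \<le> M" if "Y \<longlonglongrightarrow> M" "\<And>j. 0 \<le> Y j"
    for Y :: "nat \<Rightarrow> real^'k^'l" and M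
    unfolding less_eq_vec_def
  proof (intro allI)
    fix i j
    show "(0::real^'k^'l) $ i $ j \<le> M $ i $ j"
      using that(2) by (intro tendsto_lowerbound[OF tendsto_vec_nth[OF tendsto_vec_nth[OF that(1)]]])
        (auto simp: less_eq_vec_def)
  qed
  have "nonneg_pair ?L"
    using nonneg_limit[OF tendsto_fst[OF lim]] nonneg_limit[OF tendsto_snd[OF lim]] nonneg
    by (auto simp: nonneg_pair_def)
  from nmf_stationary_point_if_columns[OF this column_stationarity(2)[OF s lim]
      column_stationarity(1)[OF s lim]]
  show ?thesis
    by simp
qed

end
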